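(* Let $t \geq 2$ be an integer and set $n = 4t^2+1$ and $r = 2t^2-t+1$. Then the Cayley complement $\overline{C}(\mathbb{Z}_n,\{1,2t\})$ is $r$-primitive.
   Context: For a finite group $\Gamma$ and a set $S\subseteq\Gamma$, the Cayley graph $C(\Gamma,S)$ has vertex set $\Gamma$, with distinct $x,y$ adjacent iff $x=yz$ or $x=yz^{-1}$ for some $z\in S$. For $\Gamma=\mathbb{Z}_n$ (written additively) this means distinct $x,y\in\mathbb{Z}_n$ are adjacent iff $x-y\equiv \pm s \pmod n$ for some $s\in S$. The Cayley complement $\overline{C}(\Gamma,S)$ is the (simple) graph complement of $C(\Gamma,S)$. A graph $G$ (with at least $r$ vertices) is uniquely $K_r$-saturated if $G$ contains no clique on $r$ vertices and, for every pair of nonadjacent vertices $u,v$, the graph $G+uv$ contains exactly one clique on $r$ vertices. A graph is $r$-primitive if it is uniquely $K_r$-saturated and has no dominating vertex (a vertex adjacent to all other vertices). *)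

theory Defs
  imports "HOL-Algebra.Elementary_Groups" "HOL-Number_Theory.Cong"
begin

(* Finite simple graphs: an edge is a two-element set of vertices. *)

record 'a sgraph =
  vertices :: "'a set"
  edges :: "'a set set"

definition simple_graph :: "'a sgraph \<Rightarrow> bool" where
  "simple_graph G \<longleftrightarrow>
     finite (vertices G) \<and> (\<forall>e\<in>edges G. e \<subseteq> vertices G \<and> card e = 2)"

definition adjacent :: "'a sgraph \<Rightarrow> 'a \<Rightarrow> 'a \<Rightarrow> bool" where
  "adjacent G u v \<longleftrightarrow> {u, v} \<in> edges G"

definition complement :: "'a sgraph \<Rightarrow> 'a sgraph" where
  "complement G =
     \<lparr>vertices = vertices G,
      edges = {{x, y} | x y. x \<in> vertices G \<and> y \<in> vertices G \<and> x \<noteq> y \<and> \<not> adjacent G x y}\<rparr>"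

definition add_edge :: "'a sgraph \<Rightarrow> 'a \<Rightarrow> 'a \<Rightarrow> 'a sgraph" where
  "add_edge G u v = \<lparr>vertices = vertices G, edges = insert {u, v} (edges G)\<rparr>"

definition is_clique :: "'a sgraph \<Rightarrow> nat \<Rightarrow> 'a set \<Rightarrow> bool" where
  "is_clique G r K \<longleftrightarrow>
     K \<subseteq> vertices G \<and> finite K \<and> card K = r \<and>
     (\<forall>x\<in>K. \<forall>y\<in>K. x \<noteq> y \<longrightarrow> adjacent G x y)"

definition uniquely_saturated :: "nat \<Rightarrow> 'a sgraph \<Rightarrow> bool" where
  "uniquely_saturated r G \<longleftrightarrow>
     simple_graph G \<and> r \<le> card (vertices G) \<and>
     (\<nexists>K. is_clique G r K) \<and>
     (\<forall>u\<in>vertices G. \<forall>v\<in>vertices G.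
        u \<noteq> v \<and> \<not> adjacent G u v \<longrightarrow> (\<exists>!K. is_clique (add_edge G u v) r K))"

definition dominating_vertex :: "'a sgraph \<Rightarrow> 'a \<Rightarrow> bool" where
  "dominating_vertex G v \<longleftrightarrow>
     v \<in> vertices G \<and> (\<forall>u\<in>vertices G. u \<noteq> v \<longrightarrow> adjacent G v u)"

definition primitive :: "nat \<Rightarrow> 'a sgraph \<Rightarrow> bool" where
  "primitive r G \<longleftrightarrow> uniquely_saturated r G \<and> (\<nexists>v. dominating_vertex G v)"

definition cayley_graph :: "('a, 'b) monoid_scheme \<Rightarrow> 'a set \<Rightarrow> 'a sgraph" where
  "cayley_graph \<Gamma> S =
     \<lparr>vertices = carrier \<Gamma>,
      edges = {{x, y} | x y. x \<in> carrier \<Gamma> \<and> y \<in> carrier \<Gamma> \<and> x \<noteq> y \<and>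
                 (\<exists>z\<in>S. x = y \<otimes>\<^bsub>\<Gamma>\<^esub> z \<or> x = y \<otimes>\<^bsub>\<Gamma>\<^esub> inv\<^bsub>\<Gamma>\<^esub> z)}\<rparr>"

definition cayley_complement :: "('a, 'b) monoid_scheme \<Rightarrow> 'a set \<Rightarrow> 'a sgraph" where
  "cayley_complement \<Gamma> S = complement (cayley_graph \<Gamma> S)"

lemma simple_graph_cayley_complement:
  assumes "finite (carrier \<Gamma>)"
  shows "simple_graph (cayley_complement \<Gamma> S)"
  using assms
  by (auto simp: simple_graph_def cayley_complement_def complement_def cayley_graph_def)

lemma adjacent_cayley_graph_integer_mod:
  fixes n :: nat and x y :: int
  assumes n: "n > 0" and S: "S \<subseteq> carrier (integer_mod_group n)"
    and x: "x \<in> carrier (integer_mod_group n)" and y: "y \<in> carrier (integer_mod_group n)"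
  shows "adjacent (cayley_graph (integer_mod_group n) S) x y \<longleftrightarrow>
           x \<noteq> y \<and> (\<exists>s\<in>S. [x - y = s] (mod int n) \<or> [x - y = - s] (mod int n))"
proof -
  have step: "(x = y \<otimes>\<^bsub>integer_mod_group n\<^esub> s \<longleftrightarrow> [x - y = s] (mod int n)) \<and>
     (x = y \<otimes>\<^bsub>integer_mod_group n\<^esub> inv\<^bsub>integer_mod_group n\<^esub> s \<longleftrightarrow> [x - y = - s] (mod int n))"
    if "s \<in> S" "x \<in> carrier (integer_mod_group n)" "y \<in> carrier (integer_mod_group n)" for s x y
  proof -
    have xm: "x mod int n = x"
      using that n by (simp add: carrier_integer_mod_group)
    have sc: "s \<in> carrier (integer_mod_group n)"
      using that S by auto
    have *: "x = (y + a) mod int n \<longleftrightarrow> [x - y = a] (mod int n)" for a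
    proof -
      have "x = (y + a) mod int n \<longleftrightarrow> [x = y + a] (mod int n)"
        using xm by (simp add: cong_def)
      also have "\<dots> \<longleftrightarrow> [x - y = a] (mod int n)"
        by (simp add: cong_iff_dvd_diff algebra_simps)
      finally show ?thesis .
    qed
    have "inv\<^bsub>integer_mod_group n\<^esub> s = (- s) mod int n"
      using sc n by (simp add: inv_integer_mod_group)
    then show ?thesis
      using *[of s] *[of "- s"] by (simp add: mult_integer_mod_group mod_add_right_eq)
  qed
  define R where "R x y \<longleftrightarrow> (\<exists>z\<in>S. x = y \<otimes>\<^bsub>integer_mod_group n\<^esub> z \<or>
      x = y \<otimes>\<^bsub>integer_mod_group n\<^esub> inv\<^bsub>integer_mod_group n\<^esub> z)" for x y
  have R: "R x y \<longleftrightarrow> (\<exists>s\<in>S. [x - y = s] (mod int n) \<or> [x - y = - s] (mod int n))"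
    if "x \<in> carrier (integer_mod_group n)" "y \<in> carrier (integer_mod_group n)" for x y
    unfolding R_def using step[OF _ that] by blast
  have swap: "[y - x = s] (mod int n) \<longleftrightarrow> [x - y = - s] (mod int n)" for s
    by (metis cong_minus_minus_iff minus_diff_eq minus_minus)
  have "R y x \<longleftrightarrow> R x y"
    unfolding R[OF x y] R[OF y x] swap by auto
  moreover have "adjacent (cayley_graph (integer_mod_group n) S) x y \<longleftrightarrow> x \<noteq> y \<and> (R x y \<or> R y x)"
    unfolding adjacent_def cayley_graph_def R_def[symmetric]
    using x y by (auto simp: doubleton_eq_iff)
  ultimately show ?thesis
    using R[OF x y] by simp
qed

end

theory Submission
  imports Defs
begin

text \<open>Cliques of the Cayley complement are independent sets of the circulant graph on the
  residues mod N with jumps 1 and 2t. So no r-set may be independent, and for each edge uv exactly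
  one r-set may span no edge other than uv.

  With g = 2t + 1, the identity g r = N t + 1 does two jobs. It makes r the inverse of g mod N:
  writing residues as -g a turns the jumps into r and r - 1, so the interval 0..r-1 of values of a
  spans a single edge, which is {0, 2t} (\<open>near_in_extremal_set\<close>). It also makes a count
  tight: g consecutive residues carry an odd cycle, which bounds how many of them an r-set spanning
  at most the edge {0, 2t} can contain, and summing over all N windows leaves no slack. Equality
  everywhere determines the set (\<open>unique_extremal_set\<close>).

  An independent r-set would therefore be \<open>extremal_set\<close>, which spans an edge. Every
  other edge is the image of {0, 2t} under an affine automorphism with factor 1 or 2t
  (\<open>near_affine\<close>), which carries existence and uniqueness over to it
  (\<open>ex1_one_edge_set\<close>).\<close>

lemma bij_betw_affine_mod:
  fixes N p u :: int
  assumes "N > 0" and "coprime p N"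
  shows "bij_betw (\<lambda>x. (u + p * x) mod N) {0..<N} {0..<N}"
proof -
  have "inj_on (\<lambda>x. (u + p * x) mod N) {0..<N}"
  proof (rule inj_onI)
    fix x y
    assume x: "x \<in> {0..<N}" and y: "y \<in> {0..<N}"
      and "(u + p * x) mod N = (u + p * y) mod N"
    then have "[p * x = p * y] (mod N)"
      by (simp add: cong_add_lcancel flip: cong_def)
    then have "[x = y] (mod N)"
      using assms(2) by (simp add: cong_mult_lcancel)
    then show "x = y"
      using x y by (simp add: cong_def)
  qed
  moreover have "(\<lambda>x. (u + p * x) mod N) ` {0..<N} \<subseteq> {0..<N}"
    using assms(1) by auto
  ultimately show ?thesis
    by (simp add: bij_betw_def endo_inj_surj)
qed

text \<open>Going once along a path counts inner points twice and the two ends once; the leftover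
  ends will be the closing edge of an odd cycle.\<close>

lemma twice_sum_atMost_eq:
  fixes b :: "nat \<Rightarrow> 'a :: comm_ring_1"
  shows "2 * (\<Sum>i\<le>m. b i) = (\<Sum>i<m. b i + b (Suc i)) + b 0 + b m"
  by (induction m) (simp_all add: algebra_simps)

section \<open>Arithmetic of N, r and g\<close>

locale two_step_circulant =
  fixes t r :: nat and N g :: int
  assumes t_ge_2: "t \<ge> 2"
    and N_def: "N = 4 * (int t)\<^sup>2 + 1"
    and r_def: "r = 2 * t\<^sup>2 - t + 1"
    and g_def: "g = 2 * int t + 1"
begin

abbreviation "T \<equiv> int t"

text \<open>Adjacency in the circulant graph, phrased by divisibility so that it applies to
  unreduced integers.\<close>

definition near :: "int \<Rightarrow> int \<Rightarrow> bool" where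
  "near x y \<longleftrightarrow> N dvd x - y - 1 \<or> N dvd x - y + 1 \<or> N dvd x - y - 2 * T \<or> N dvd x - y + 2 * T"

definition extremal_set :: "int set" where
  "extremal_set = (\<lambda>i. (- g * int i) mod N) ` {..<r}"

lemma int_r: "int r = 2 * T\<^sup>2 - T + 1"
proof -
  have "t \<le> 2 * t\<^sup>2"
    by (simp add: power2_eq_square)
  then show ?thesis
    by (simp add: r_def)
qed

lemma g_r: "g * int r = N * T + 1"
  unfolding int_r N_def g_def by (simp add: algebra_simps power2_eq_square)

lemma four_T_sq: "2 * T * (2 * T) = N - 1"
  by (simp add: N_def power2_eq_square)

lemma N_gt: "N > 4 * T" "N > 2 * T" "N > 1"
proof -
  have "2 * T \<le> T * T"
    using t_ge_2 by (intro mult_right_mono) auto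
  then show "N > 4 * T" "N > 2 * T" "N > 1"
    using t_ge_2 by (auto simp: N_def power2_eq_square)
qed

lemma coprime_g: "coprime g N"
proof (rule coprimeI)
  fix c assume "c dvd g" "c dvd N"
  then have "c dvd g * int r - N * T"
    by (intro dvd_diff dvd_mult2)
  then show "is_unit c"
    by (simp add: g_r)
qed

lemma coprime_2T: "coprime (2 * T) N"
proof (rule coprimeI)
  fix c assume "c dvd 2 * T" "c dvd N"
  then have "c dvd N - 2 * T * (2 * T)"
    by (meson dvd_diff dvd_mult)
  then show "is_unit c"
    by (simp add: four_T_sq)
qed

lemma N_dvd_small: "N dvd x \<Longrightarrow> \<bar>x\<bar> < N \<Longrightarrow> x = 0"
  using zdvd_imp_le[of N "\<bar>x\<bar>"] by fastforce

section \<open>Symmetries of the circulant graph\<close>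

lemma near_sym: "near x y \<longleftrightarrow> near y x"
proof -
  have "N dvd x - y - a \<longleftrightarrow> N dvd y - x + a" for a
    using dvd_minus_iff[of N "x - y - a"] by (simp add: algebra_simps)
  from this[of 1] this[of "-1"] this[of "2 * T"] this[of "- 2 * T"]
  show ?thesis
    unfolding near_def by auto
qed

lemma near_mod: "near (x mod N) (y mod N) \<longleftrightarrow> near x y"
proof -
  have "N dvd x mod N - y mod N + a \<longleftrightarrow> N dvd x - y + a" for a
    by (metis (no_types, lifting) dvd_eq_mod_eq_0 mod_add_left_eq mod_diff_eq)
  from this[of 1] this[of "-1"] this[of "2 * T"] this[of "- 2 * T"]
  show ?thesis
    unfolding near_def by simp
qed

lemma near_imp_neq: "near x y \<Longrightarrow> x \<noteq> y"
  unfolding near_def using N_dvd_small[of 1] N_dvd_small[of "2 * T"] N_gt t_ge_2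
  by auto

text \<open>As \<open>(2t)\<^sup>2 = - 1\<close> modulo \<open>N\<close>, multiplication by \<open>2t\<close> is an automorphism exchanging the two
  kinds of edges.\<close>
lemma near_affine:
  assumes "p = 1 \<or> p = 2 * T"
  shows "near (u + p * x) (u + p * y) \<longleftrightarrow> near x y"
proof (cases "p = 1")
  case False
  with assms have p: "p = 2 * T"
    by simp
  have *: "N dvd 2 * T * z + 2 * T * a \<longleftrightarrow> N dvd z + a" for z a
  proof -
    have "coprime N (2 * T)"
      using coprime_2T by (simp add: coprime_commute)
    then show ?thesis
      by (metis coprime_dvd_mult_right_iff distrib_left)
  qed
  \<comment> \<open>Modulo \<open>N\<close> the inverse of \<open>2 * T\<close> is
    \<open>- 2 * T\<close>, so cancelling the factor turns the offset \<open>a\<close> into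
    \<open>- 2 * T * a\<close>.\<close>
  have **: "N dvd 2 * T * z + a \<longleftrightarrow> N dvd z - 2 * T * a" for z a
  proof -
    have "2 * T * z + a = 2 * T * z + 2 * T * (- 2 * T * a) + N * a"
      by (simp add: N_def algebra_simps power2_eq_square)
    then have "N dvd 2 * T * z + a \<longleftrightarrow> N dvd 2 * T * z + 2 * T * (- 2 * T * a)"
      by (metis dvd_add_left_iff dvd_triv_left)
    then show ?thesis
      using *[of z "- 2 * T * a"] by simp
  qed
  have "u + p * x - (u + p * y) = 2 * T * (x - y)"
    by (simp add: p algebra_simps)
  then show ?thesis
    unfolding near_def
    using **[of "x - y" 1] **[of "x - y" "-1"] *[of "x - y" 1] *[of "x - y" "-1"]
    by auto
qed (simp add: near_def)

section \<open>The extremal set and its single edge\<close>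

lemma extremal_set_subset: "extremal_set \<subseteq> {0..<N}"
  using N_gt by (auto simp: extremal_set_def)

lemma N_dvd_g_mult_iff: "N dvd g * a \<longleftrightarrow> N dvd a"
  using coprime_g by (metis coprime_commute coprime_dvd_mult_right_iff)

lemma r_bounds: "2 * int r \<le> N" "r > 1"
proof -
  have "2 * T \<le> T * T"
    using t_ge_2 by (intro mult_right_mono) auto
  then have "int r > 1"
    unfolding int_r using t_ge_2 by (simp add: power2_eq_square)
  then show "r > 1"
    by linarith
  show "2 * int r \<le> N"
    unfolding int_r N_def using t_ge_2 by simp
qed

lemma card_extremal_set: "card extremal_set = r"
proof -
  have "inj_on (\<lambda>i. (- g * int i) mod N) {..<r}"
  proof (rule inj_onI)
    fix i j assume ij: "i \<in> {..<r}" "j \<in> {..<r}"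
      and "(- g * int i) mod N = (- g * int j) mod N"
    then have "N dvd - g * int i - (- g * int j)"
      by (simp only: mod_eq_dvd_iff)
    then have "N dvd g * (int j - int i)"
      by (simp add: algebra_simps)
    then have "int j - int i = 0"
      unfolding N_dvd_g_mult_iff using ij r_bounds by (intro N_dvd_small) auto
    then show "i = j"
      by simp
  qed
  then show ?thesis
    by (simp add: extremal_set_def card_image)
qed

text \<open>Modulo \<open>N\<close>, 1 equals \<open>g * r\<close> and \<open>2 * T = g - 1\<close>
  equals \<open>g * (1 - r)\<close>. Dividing by \<open>- g\<close> therefore turns the jumps 1 and
  \<open>2 * T\<close> into \<open>r\<close> and \<open>r - 1\<close>, up to sign.\<close>

lemma near_multiples:
  "near (- g * a) (- g * b) \<longleftrightarrow> N dvd a - b + int r \<or> N dvd a - b - int r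
     \<or> N dvd a - b - (int r - 1) \<or> N dvd a - b + (int r - 1)"
proof -
  have 1: "N dvd - g * a - (- g * b) + c \<longleftrightarrow> N dvd a - b - int r * c" for c
  proof -
    have "- g * a - (- g * b) + c = - (g * (a - b - int r * c)) - N * (T * c)"
    proof -
      have "g * (int r * c) = (N * T + 1) * c"
        by (simp only: g_r flip: mult.assoc)
      then show ?thesis
        by (simp add: algebra_simps)
    qed
    then show ?thesis
      by (metis dvd_diff_left_iff dvd_minus_iff dvd_triv_left N_dvd_g_mult_iff)
  qed
  have 2: "N dvd a - b - int r * (2 * T * s) \<longleftrightarrow> N dvd a - b + (int r - 1) * s" for s
  proof -
    have "int r * (2 * T) = N * T + 1 - int r"
      using g_r by (simp add: g_def algebra_simps)
    then have "int r * (2 * T) * s = (N * T + 1 - int r) * s"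
      by simp
    then have "a - b - int r * (2 * T * s) = (a - b + (int r - 1) * s) - N * (T * s)"
      by (simp add: algebra_simps)
    then show ?thesis
      by (metis dvd_diff_left_iff dvd_triv_left)
  qed
  show ?thesis
    unfolding near_def
    using 1[of 1] 1[of "-1"] 1[of "2 * T"] 1[of "- 2 * T"] 2[of 1] 2[of "-1"]
    by (auto simp: algebra_simps)
qed

lemma zero_mem_extremal_set: "0 \<in> extremal_set"
  unfolding extremal_set_def using r_bounds by (intro image_eqI[of _ _ 0]) auto

lemma g_multiple_eq_2T: "(- g * (int r - 1)) mod N = 2 * T"
proof -
  have "- g * (int r - 1) = 2 * T + N * (- T)"
    using g_r by (simp add: g_def algebra_simps)
  then have "(- g * (int r - 1)) mod N = 2 * T mod N"
    by (metis mod_mult_self2)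
  then show ?thesis
    using N_gt by simp
qed

lemma two_T_mem_extremal_set: "2 * T \<in> extremal_set"
  unfolding extremal_set_def
  by (rule image_eqI[of _ _ "r - 1"]) (use r_bounds g_multiple_eq_2T in \<open>auto simp: of_nat_diff\<close>)

lemma near_0_2T: "near 0 (2 * T)"
  by (simp add: near_def)

text \<open>Indices below \<open>r\<close> differ by at most \<open>r - 1\<close>, and
  \<open>2 * r \<le> N\<close> rules out wrapping around, so only the two end indices can be joined;
  they give 0 and \<open>2 * T\<close>.\<close>

lemma near_in_extremal_set:
  assumes "x \<in> extremal_set" "y \<in> extremal_set" "near x y"
  shows "{x, y} = {0, 2 * T}"
proof -
  obtain i j where ij: "i < r" "j < r" "x = (- g * int i) mod N" "y = (- g * int j) mod N"
    using assms(1,2) by (auto simp: extremal_set_def)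
  have "near (- g * int i) (- g * int j)"
    using assms(3) by (simp only: ij near_mod)
  moreover have "\<not> N dvd int i - int j + int r" "\<not> N dvd int i - int j - int r"
    using ij r_bounds N_dvd_small[of "int i - int j + int r"] N_dvd_small[of "int i - int j - int r"]
    by auto
  ultimately have "int i - int j = int r - 1 \<or> int i - int j = - (int r - 1)"
    unfolding near_multiples
    using ij r_bounds N_dvd_small[of "int i - int j + (int r - 1)"]
      N_dvd_small[of "int i - int j - (int r - 1)"]
    by linarith
  then have "int i = int r - 1 \<and> int j = 0 \<or> int j = int r - 1 \<and> int i = 0"
    using ij by linarith
  then show ?thesis
    using g_multiple_eq_2T unfolding ij(3,4) by auto
qed

section \<open>Uniqueness by counting over windows\<close>

text \<open>Every window \<open>{x..x + 2t}\<close> spans an odd cycle of length \<open>2t + 1\<close>, so it meets \<open>K\<close> in at most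
  \<open>t\<close> points, except that \<open>{0..2t}\<close> may contain \<open>t + 1\<close>. Since \<open>(2t + 1) r = N t + 1\<close>, all these
  bounds are attained, and comparing consecutive windows shows that membership in \<open>K\<close> is invariant
  under translation by \<open>2t + 1\<close> except at two points.\<close>
lemma unique_extremal_set:
  assumes K: "K \<subseteq> {0..<N}" "card K = r"
    and only: "\<And>x y. x \<in> K \<Longrightarrow> y \<in> K \<Longrightarrow> near x y \<Longrightarrow> {x, y} = {0, 2 * T}"
  shows "K = extremal_set"
proof -
  define f :: "int \<Rightarrow> int" where "f x = of_bool (x mod N \<in> K)" for x
  define a where "a x = (\<Sum>i\<le>2 * t. f (x + int i))" for x
  have f01: "f x = 0 \<or> f x = 1" for x
    by (auto simp: f_def)
  have near_f: "f x + f y \<le> 1" if "near x y" "{x mod N, y mod N} \<noteq> {0, 2 * T}" for x y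
    using only[of "x mod N" "y mod N"] that by (auto simp: f_def near_mod)
  have mod_diff: "N dvd x - y - c" if "x mod N - y mod N = c" for x y c
    using that by (metis mod_eq_dvd_iff mod_diff_eq mod_mod_trivial)
  have step1: "f x + f (x + 1) \<le> 1" for x
  proof (rule near_f)
    show "near x (x + 1)"
      by (simp add: near_def)
    show "{x mod N, (x + 1) mod N} \<noteq> {0, 2 * T}"
    proof
      assume "{x mod N, (x + 1) mod N} = {0, 2 * T}"
      then have "(x + 1) mod N - x mod N = 2 * T \<or> (x + 1) mod N - x mod N = - 2 * T"
        by (auto simp: doubleton_eq_iff)
      then have "N dvd 1 - 2 * T \<or> N dvd 1 + 2 * T"
        using mod_diff[of "x + 1" x "2 * T"] mod_diff[of "x + 1" x "- 2 * T"] by auto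
      then show False
        using N_dvd_small[of "1 - 2 * T"] N_dvd_small[of "1 + 2 * T"] N_gt t_ge_2 by linarith
    qed
  qed
  \<comment> \<open>The exceptional edge read from 0 is excluded by the hypothesis; read from
    \<open>2 * T\<close> it would force \<open>N\<close> to divide \<open>4 * T\<close>.\<close>
  have step2: "f x + f (x + 2 * T) \<le> 1" if "\<not> N dvd x" for x
  proof (rule near_f)
    show "near x (x + 2 * T)"
      by (simp add: near_def)
    show "{x mod N, (x + 2 * T) mod N} \<noteq> {0, 2 * T}"
    proof
      assume "{x mod N, (x + 2 * T) mod N} = {0, 2 * T}"
      then have "(x + 2 * T) mod N - x mod N = - 2 * T"
        using that by (auto simp: doubleton_eq_iff dvd_eq_mod_eq_0)
      then have "N dvd 4 * T"
        using mod_diff[of "x + 2 * T" x "- 2 * T"] by simp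
      then show False
        using N_dvd_small[of "4 * T"] N_gt t_ge_2 by linarith
    qed
  qed
  have twice_a: "2 * a x \<le> 2 * T + f x + f (x + 2 * T)" for x
  proof -
    have "(\<Sum>i<2 * t. f (x + int i) + f (x + int (Suc i))) \<le> (\<Sum>i<2 * t. 1)"
      using step1 by (intro sum_mono) (metis add.assoc add.commute of_nat_Suc)
    then show ?thesis
      unfolding a_def twice_sum_atMost_eq by simp
  qed
  \<comment> \<open>Away from multiples of \<open>N\<close> the ends \<open>x\<close> and
    \<open>x + 2 * T\<close> are joined too, so \<open>2 * a x \<le> 2 * T + 1\<close>, and
    integrality drops the 1.\<close>
  have a_le: "a x \<le> T + of_bool (N dvd x)" for x
    using twice_a[of x] step2[of x] f01[of x] f01[of "x + 2 * T"] by (cases "N dvd x") auto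
  have sum_f: "(\<Sum>x\<in>{0..<N}. f (x + c)) = int r" for c
  proof -
    have "bij_betw (\<lambda>x. (c + 1 * x) mod N) {0..<N} {0..<N}"
      using N_gt by (intro bij_betw_affine_mod) auto
    then have "(\<Sum>x\<in>{0..<N}. f ((c + 1 * x) mod N)) = (\<Sum>x\<in>{0..<N}. f x)"
      by (rule sum.reindex_bij_betw)
    moreover have "f ((c + 1 * x) mod N) = f (x + c)" for x
      by (simp add: f_def add.commute)
    moreover have "(\<Sum>x\<in>{0..<N}. f x) = (\<Sum>x\<in>{0..<N}. of_bool (x \<in> K))"
      by (intro sum.cong) (auto simp: f_def)
    moreover have "\<dots> = int (card K)"
      using K(1) by (simp add: Int_absorb1 flip: Int_def)
    ultimately show ?thesis
      using K(2) by simp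
  qed
  \<comment> \<open>Each point of \<open>K\<close> lies in \<open>g\<close> windows. The total
    \<open>g * r\<close> equals the sum of the upper bounds in \<open>a_le\<close>, so each of them
    is attained.\<close>
  have "(\<Sum>x\<in>{0..<N}. a x) = (\<Sum>i\<le>2 * t. int r)"
    unfolding a_def by (subst sum.swap) (simp only: sum_f)
  also have "\<dots> = N * T + 1"
    unfolding g_r[symmetric] by (simp add: g_def)
  also have "\<dots> = (\<Sum>x\<in>{0..<N}. T + of_bool (N dvd x))"
  proof -
    have "(\<Sum>x\<in>{0..<N}. of_bool (N dvd x)) = (\<Sum>x\<in>{0..<N}. of_bool (x = 0) :: int)"
      using N_dvd_small by (intro sum.cong) auto
    also have "\<dots> = 1"
      using N_gt by (simp add: of_bool_def)
    finally show ?thesis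
      using N_gt by (simp add: sum.distrib)
  qed
  finally have sum0: "(\<Sum>x\<in>{0..<N}. T + of_bool (N dvd x) - a x) = 0"
    by (simp add: sum_subtractf)
  have a_eq: "a x = T + of_bool (N dvd x)" for x
  proof -
    have "\<forall>x\<in>{0..<N}. T + of_bool (N dvd x) - a x = 0"
      using sum0 a_le by (subst (asm) sum_nonneg_eq_0_iff) auto
    moreover have "x mod N \<in> {0..<N}"
      using N_gt by simp
    moreover have "a (x mod N) = a x"
      by (simp add: a_def f_def mod_add_left_eq)
    moreover have "N dvd x mod N \<longleftrightarrow> N dvd x"
      by (simp add: dvd_mod_iff)
    ultimately show ?thesis
      by fastforce
  qed
  \<comment> \<open>Passing from the window at \<open>x\<close> to the one at \<open>x + 1\<close>
    loses \<open>x\<close> and gains \<open>x + g\<close>.\<close>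
  have shift: "f (x + g) - f x = of_bool (N dvd x + 1) - of_bool (N dvd x)" for x
  proof -
    have "a (x + 1) + f x = a x + f (x + g)"
    proof -
      have "a (x + 1) + f x = (\<Sum>i\<le>Suc (2 * t). f (x + int i))"
        unfolding a_def by (subst sum.atMost_Suc_shift) (simp add: algebra_simps)
      also have "\<dots> = a x + f (x + g)"
        by (simp add: a_def g_def algebra_simps)
      finally show ?thesis .
    qed
    then show ?thesis
      by (simp add: a_eq)
  qed
  \<comment> \<open>The window at 0 has \<open>T + 1\<close> points, so \<open>twice_a\<close>
    forces both of its ends into \<open>K\<close>.\<close>
  have f0: "f 0 = 1"
    using twice_a[of 0] f01[of 0] f01[of "2 * T"] by (auto simp: a_eq)
  \<comment> \<open>Stepping down by \<open>g\<close> from a point of \<open>K\<close>, membership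
    can be lost only on reaching -1 mod \<open>N\<close>. As \<open>g * r\<close> is 1 mod
    \<open>N\<close>, that happens first at index \<open>r\<close>.\<close>
  have "f (- g * int i) = 1" if "i < r" for i
    using that
  proof (induction i)
    case (Suc i)
    have "\<not> N dvd - g * int (Suc i) + 1"
    proof
      assume "N dvd - g * int (Suc i) + 1"
      moreover have "- g * int (Suc i) + 1 = g * (int r - int (Suc i)) - N * T"
        using g_r by (simp add: algebra_simps)
      ultimately have "N dvd int r - int (Suc i)"
        by (metis dvd_diff_left_iff dvd_triv_left N_dvd_g_mult_iff)
      then show False
        using N_dvd_small[of "int r - int (Suc i)"] Suc.prems r_bounds by linarith
    qed
    moreover have "- g * int (Suc i) + g = - g * int i"
      by (simp add: algebra_simps)
    ultimately show ?case
      using shift[of "- g * int (Suc i)"] Suc f01[of "- g * int (Suc i)"]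
      by (auto simp: of_bool_def split: if_splits)
  qed (use f0 in simp)
  then have "extremal_set \<subseteq> K"
    by (auto simp: extremal_set_def f_def)
  moreover have "finite K"
    using K(1) finite_subset by blast
  ultimately show ?thesis
    using card_extremal_set K(2) by (metis card_subset_eq)
qed

section \<open>Independent sets and arbitrary edges\<close>

text \<open>An independent r-set meets the condition of \<open>unique_extremal_set\<close>
  vacuously, yet \<open>extremal_set\<close> contains the edge from 0 to
  \<open>2 * T\<close>.\<close>

lemma no_independent_set:
  assumes "K \<subseteq> {0..<N}" "card K = r" "\<And>x y. x \<in> K \<Longrightarrow> y \<in> K \<Longrightarrow> \<not> near x y"
  shows False
  using unique_extremal_set[OF assms(1,2)] assms(3) near_0_2T
    zero_mem_extremal_set two_T_mem_extremal_set by blast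

text \<open>An affine automorphism moves {0, 2t} onto {u, v}; the image of
  \<open>extremal_set\<close> gives existence, and pulling a competitor back gives
  uniqueness.\<close>

lemma ex1_one_edge_set:
  assumes uv: "u \<in> {0..<N}" "v \<in> {0..<N}" "near u v"
  shows "\<exists>!K. K \<subseteq> {0..<N} \<and> card K = r \<and>
    (\<forall>x\<in>K. \<forall>y\<in>K. near x y \<longrightarrow> {x, y} = {u, v})"
proof -
  \<comment> \<open>A jump of \<open>2 * T\<close> in either direction needs only a translation from
    the right endpoint; a jump of 1 uses \<open>p = 2 * T\<close>, because
    \<open>p * (2 * T)\<close> is then -1 mod \<open>N\<close>.\<close>
  have "\<exists>w p. (p = 1 \<or> p = 2 * T) \<and> w \<in> {0..<N} \<and> {w, (w + p * (2 * T)) mod N} = {u, v}"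
  proof -
    have *: "(b + c) mod N = a" if "N dvd a - b - c" "a \<in> {0..<N}" for a b c
    proof -
      have "(b + c) mod N = a mod N"
        using that(1) by (subst mod_eq_dvd_iff, subst dvd_minus_iff[symmetric]) (simp add: algebra_simps)
      then show ?thesis
        using that(2) by simp
    qed
    have dvd_sq: "N dvd a - b - 2 * T * (2 * T) \<longleftrightarrow> N dvd a - b + 1" for a b
    proof -
      have "a - b - 2 * T * (2 * T) = a - b + 1 - N"
        by (simp add: four_T_sq)
      then show ?thesis
        by (metis dvd_diff_left_iff dvd_refl)
    qed
    have flip: "N dvd u - v - c \<longleftrightarrow> N dvd v - u + c" for c
      using dvd_minus_iff[of N "u - v - c"] by (simp add: algebra_simps)
    from uv(3) consider "N dvd u - v - 1 * (2 * T)" | "N dvd v - u - 1 * (2 * T)"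
      | "N dvd u - v - 2 * T * (2 * T)" | "N dvd v - u - 2 * T * (2 * T)"
      unfolding near_def dvd_sq using flip[of 1] flip[of "- 2 * T"] by auto
    then show ?thesis
    proof cases
      case 1 then show ?thesis using *[OF 1] uv by (intro exI[of _ v] exI[of _ 1]) auto
    next
      case 2 then show ?thesis using *[OF 2] uv by (intro exI[of _ u] exI[of _ 1]) auto
    next
      case 3 then show ?thesis using *[OF 3] uv by (intro exI[of _ v] exI[of _ "2 * T"]) auto
    next
      case 4 then show ?thesis using *[OF 4] uv by (intro exI[of _ u] exI[of _ "2 * T"]) auto
    qed
  qed
  then obtain w p where p: "p = 1 \<or> p = 2 * T" and w: "w \<in> {0..<N}"
    and wuv: "{w, (w + p * (2 * T)) mod N} = {u, v}"
    by blast
  define \<phi> where "\<phi> x = (w + p * x) mod N" for x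
  have bij: "bij_betw \<phi> {0..<N} {0..<N}"
    unfolding \<phi>_def using p N_gt coprime_2T by (intro bij_betw_affine_mod) auto
  then have inj: "inj_on \<phi> {0..<N}" and im: "\<phi> ` {0..<N} = {0..<N}"
    by (auto simp: bij_betw_def)
  have near_\<phi>: "near (\<phi> x) (\<phi> y) \<longleftrightarrow> near x y" for x y
    unfolding \<phi>_def near_mod using near_affine[OF p] .
  have edge: "\<phi> ` {0, 2 * T} = {u, v}"
    using wuv w by (simp add: \<phi>_def)
  have sub: "{0, 2 * T} \<subseteq> {0..<N}"
    using N_gt by auto
  show ?thesis
  proof (rule ex1I[of _ "\<phi> ` extremal_set"], intro conjI ballI impI)
    show "\<phi> ` extremal_set \<subseteq> {0..<N}"
      using im extremal_set_subset by blast
    show "card (\<phi> ` extremal_set) = r"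
      using card_image[OF inj_on_subset[OF inj extremal_set_subset]] card_extremal_set by simp
  next
    fix x y assume "x \<in> \<phi> ` extremal_set" "y \<in> \<phi> ` extremal_set" "near x y"
    then obtain i j where ij: "x = \<phi> i" "y = \<phi> j" "i \<in> extremal_set" "j \<in> extremal_set"
      and "near i j"
      by (auto simp: near_\<phi>)
    then have "\<phi> ` {i, j} = {u, v}"
      using near_in_extremal_set[of i j] edge by simp
    then show "{x, y} = {u, v}"
      by (simp add: ij)
  next
    fix K assume "K \<subseteq> {0..<N} \<and> card K = r \<and>
      (\<forall>x\<in>K. \<forall>y\<in>K. near x y \<longrightarrow> {x, y} = {u, v})"
    then have K: "K \<subseteq> {0..<N}" "card K = r"
      "\<And>x y. x \<in> K \<Longrightarrow> y \<in> K \<Longrightarrow> near x y \<Longrightarrow> {x, y} = {u, v}"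
      by auto
    then obtain J where J: "J \<subseteq> {0..<N}" "K = \<phi> ` J"
      using im by (metis subset_imageE)
    have "J = extremal_set"
    proof (rule unique_extremal_set[OF J(1)])
      show "card J = r"
        using card_image[OF inj_on_subset[OF inj J(1)]] J(2) K(2) by simp
      fix x y assume xy: "x \<in> J" "y \<in> J" "near x y"
      then have "\<phi> ` {x, y} = \<phi> ` {0, 2 * T}"
        using K(3)[of "\<phi> x" "\<phi> y"] J(2) near_\<phi> edge by simp
      moreover have "{x, y} \<subseteq> {0..<N}"
        using xy J(1) by auto
      ultimately show "{x, y} = {0, 2 * T}"
        by (simp only: inj_on_image_eq_iff[OF inj _ sub])
    qed
    then show "K = \<phi> ` extremal_set"
      using J(2) by simp
  qed
qed

end

section \<open>Transfer to cliques of the Cayley complement\<close>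

theorem theorem2:
  fixes t n r :: nat
  assumes "t \<ge> 2" and "n = 4 * t\<^sup>2 + 1" and "r = 2 * t\<^sup>2 - t + 1"
  shows "primitive r (cayley_complement (integer_mod_group n) {1, 2 * int t})"
proof -
  interpret two_step_circulant t r "int n" "2 * int t + 1"
    by unfold_locales (use assms in auto)
  let ?Z = "integer_mod_group n"
  define G where "G = cayley_complement ?Z {1, 2 * T}"
  have "n > 0"
    by (simp add: assms(2))
  have carrier: "carrier ?Z = {0..<int n}"
    using \<open>n > 0\<close> by (simp add: carrier_integer_mod_group)
  have V: "vertices G = {0..<int n}"
    by (simp add: G_def cayley_complement_def complement_def cayley_graph_def carrier)
  have cayley: "adjacent (cayley_graph ?Z {1, 2 * T}) x y \<longleftrightarrow> near x y"
    if "x \<in> {0..<int n}" "y \<in> {0..<int n}" for x y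
  proof -
    have "{1, 2 * T} \<subseteq> carrier ?Z"
      using N_gt by (auto simp: carrier)
    with \<open>n > 0\<close> have "adjacent (cayley_graph ?Z {1, 2 * T}) x y \<longleftrightarrow> x \<noteq> y \<and>
        (\<exists>s\<in>{1, 2 * T}. [x - y = s] (mod int n) \<or> [x - y = - s] (mod int n))"
      using adjacent_cayley_graph_integer_mod[of n "{1, 2 * T}" x y] that
      unfolding carrier by blast
    also have "\<dots> \<longleftrightarrow> x \<noteq> y \<and> near x y"
      by (auto simp: near_def cong_iff_dvd_diff)
    finally show ?thesis
      using near_imp_neq by blast
  qed
  have adj: "adjacent G x y \<longleftrightarrow> x \<noteq> y \<and> \<not> near x y"
    if "x \<in> {0..<int n}" "y \<in> {0..<int n}" for x y
  proof -
    have "adjacent G x y \<longleftrightarrow> (\<exists>a b. {x, y} = {a, b} \<and> a \<in> {0..<int n} \<and> b \<in> {0..<int n} \<and> a \<noteq> b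
        \<and> \<not> adjacent (cayley_graph ?Z {1, 2 * T}) a b)"
      unfolding adjacent_def[of G]
      by (simp add: G_def cayley_complement_def complement_def)
        (simp add: cayley_graph_def carrier)
    also have "\<dots> \<longleftrightarrow> x \<noteq> y \<and> \<not> near x y"
      using that cayley near_sym by (auto simp: doubleton_eq_iff)
    finally show ?thesis .
  qed
  have clique: "is_clique G r K \<longleftrightarrow> K \<subseteq> {0..<int n} \<and> card K = r \<and> (\<forall>x\<in>K. \<forall>y\<in>K. \<not> near x y)" for K
    unfolding is_clique_def V using adj near_imp_neq finite_subset[of K "{0..<int n}"]
    by (smt (verit, best) finite_atLeastLessThan_int subsetD)
  \<comment> \<open>Adding uv to the complement amounts to tolerating this one edge in an otherwise
    independent set.\<close>
  have clique_add: "is_clique (add_edge G u v) r K \<longleftrightarrow> K \<subseteq> {0..<int n} \<and> card K = r \<and>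
      (\<forall>x\<in>K. \<forall>y\<in>K. near x y \<longrightarrow> {x, y} = {u, v})" for u v K
  proof -
    have "adjacent (add_edge G u v) x y \<longleftrightarrow> {x, y} = {u, v} \<or> adjacent G x y" for x y
      by (simp add: adjacent_def add_edge_def)
    moreover have "vertices (add_edge G u v) = {0..<int n}"
      by (simp add: add_edge_def V)
    ultimately show ?thesis
      unfolding is_clique_def using adj near_imp_neq finite_subset[of K "{0..<int n}"]
      by (smt (verit, best) finite_atLeastLessThan_int subsetD)
  qed
  have "simple_graph G"
    unfolding G_def by (rule simple_graph_cayley_complement) (simp add: carrier)
  moreover have "r \<le> card (vertices G)"
    using r_bounds by (simp add: V)
  moreover have "\<nexists>K. is_clique G r K"
    unfolding clique using no_independent_set by blast
  moreover have "\<exists>!K. is_clique (add_edge G u v) r K"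
    if "u \<in> vertices G" "v \<in> vertices G" "u \<noteq> v" "\<not> adjacent G u v" for u v
    unfolding clique_add using that adj by (intro ex1_one_edge_set) (auto simp: V)
  moreover have "\<not> dominating_vertex G v" for v
  proof
    assume "dominating_vertex G v"
    then have v: "v \<in> {0..<int n}" "\<And>u. u \<in> {0..<int n} \<Longrightarrow> u \<noteq> v \<Longrightarrow> adjacent G v u"
      by (auto simp: dominating_vertex_def V)
    \<comment> \<open>The successor of \<open>v\<close> is joined to it in the Cayley graph, hence
      not in \<open>G\<close>.\<close>
    let ?u = "(v + 1) mod int n"
    have u: "?u \<in> {0..<int n}"
      using N_gt by simp
    have "near v ?u"
      using near_mod[of v "v + 1"] v(1) by (simp add: near_def)
    then show False
      using v(2)[OF u] adj[OF v(1) u] near_imp_neq[of v ?u] by auto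
  qed
  ultimately show ?thesis
    unfolding primitive_def uniquely_saturated_def G_def by blast
qed

end
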